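(* Two right triangles are equisectionally equivalent if and only if they are either similar or reversely similar. Moreover, a triangle $\Delta$ is equisectionally equivalent to some right triangle if and only if $\alpha(\Delta)\ge(\sqrt3-1)^2/2$.
   Context: Triangles are nondegenerate triangles in the Euclidean plane $\cong\mathbb{C}$. Two triangles are called similar if some orientation-preserving similarity of the plane carries one onto the other (labels of vertices need not be matched), and reversely similar if some orientation-reversing similarity of the plane carries one onto the other. Equisection operators: for $q\in\mathbb{R}$ and a triangle $\triangle ABC$ with vertices listed anticlockwise, $T_q(\triangle ABC)=\triangle A'B'C'$ where $A'=qB+(1-q)C$, $B'=qC+(1-q)A$, $C'=qA+(1-q)B$. Equisectional equivalence is the equivalence relation on the set of triangles generated by similarity and $\{T_q\}_{q\in\mathbb{R}}$. For a triangle $\Delta=\triangle ABC$, let $D$ and $\overline{D}$ be the two points such that $\triangle DBC$ and $\triangle\overline{D}BC$ are regular triangles, with $D$ on the same side of the line $BC$ as $A$; then $\alpha(\Delta)=|AD|/|A\overline{D}|$. It is independent of the choice of base $BC$. *)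

theory Defs
  imports "HOL-Analysis.Analysis"
begin

section \<open>Triangles and similarity\<close>

text \<open>
  The Euclidean plane is the type of complex numbers.  A triangle is an unlabelled one: it is
  identified with its set of vertices.
\<close>

definition is_triangle :: "complex set \<Rightarrow> bool" where
  "is_triangle \<Delta> \<longleftrightarrow> (\<exists>A B C. \<Delta> = {A, B, C} \<and> \<not> collinear {A, B, C})"

definition right_triangle :: "complex set \<Rightarrow> bool" where
  "right_triangle \<Delta> \<longleftrightarrow>
     (\<exists>A B C. \<Delta> = {A, B, C} \<and> \<not> collinear {A, B, C} \<and> orthogonal (B - A) (C - A))"

text \<open>Twice the signed area of the triangle \<open>ABC\<close>.\<close>

definition orient :: "complex \<Rightarrow> complex \<Rightarrow> complex \<Rightarrow> real" where
  "orient A B C = Im (cnj (B - A) * (C - A))"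

definition anticlockwise :: "complex \<Rightarrow> complex \<Rightarrow> complex \<Rightarrow> bool" where
  "anticlockwise A B C \<longleftrightarrow> orient A B C > 0"

definition similarity :: "(complex \<Rightarrow> complex) \<Rightarrow> bool" where
  "similarity f \<longleftrightarrow> (\<exists>r>0. \<forall>x y. dist (f x) (f y) = r * dist x y)"

definition orientation_preserving :: "(complex \<Rightarrow> complex) \<Rightarrow> bool" where
  "orientation_preserving f \<longleftrightarrow>
     (\<forall>A B C. anticlockwise A B C \<longrightarrow> anticlockwise (f A) (f B) (f C))"

definition orientation_reversing :: "(complex \<Rightarrow> complex) \<Rightarrow> bool" where
  "orientation_reversing f \<longleftrightarrow>
     (\<forall>A B C. anticlockwise A B C \<longrightarrow> anticlockwise (f A) (f C) (f B))"

definition similar :: "complex set \<Rightarrow> complex set \<Rightarrow> bool" where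
  "similar \<Delta> \<Delta>' \<longleftrightarrow> (\<exists>f. similarity f \<and> orientation_preserving f \<and> f ` \<Delta> = \<Delta>')"

definition reversely_similar :: "complex set \<Rightarrow> complex set \<Rightarrow> bool" where
  "reversely_similar \<Delta> \<Delta>' \<longleftrightarrow> (\<exists>f. similarity f \<and> orientation_reversing f \<and> f ` \<Delta> = \<Delta>')"


section \<open>Equisection\<close>

text \<open>
  An unlabelled triangle has three anticlockwise listings of its vertices, which differ by cyclic
  rotation; the formula below collects the vertex \<open>A'\<close> belonging to each of them, hence all of
  \<open>A'\<close>, \<open>B'\<close>, \<open>C'\<close>; see \<open>equisection_eq\<close> below.
\<close>

definition equisection :: "real \<Rightarrow> complex set \<Rightarrow> complex set" where
  "equisection q \<Delta> =
     {q *\<^sub>R B + (1 - q) *\<^sub>R C | B C. \<exists>A. \<Delta> = {A, B, C} \<and> anticlockwise A B C}"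

definition equisection_step :: "complex set \<Rightarrow> complex set \<Rightarrow> bool" where
  "equisection_step \<Delta> \<Delta>' \<longleftrightarrow>
     is_triangle \<Delta> \<and> is_triangle \<Delta>' \<and> (similar \<Delta> \<Delta>' \<or> (\<exists>q. \<Delta>' = equisection q \<Delta>))"

definition equisectionally_equivalent :: "complex set \<Rightarrow> complex set \<Rightarrow> bool" where
  "equisectionally_equivalent = equivclp equisection_step"


section \<open>The shape parameter\<close>

definition regular_triangle :: "complex \<Rightarrow> complex \<Rightarrow> complex \<Rightarrow> bool" where
  "regular_triangle A B C \<longleftrightarrow> A \<noteq> B \<and> dist A B = dist B C \<and> dist B C = dist C A"

definition same_side :: "complex \<Rightarrow> complex \<Rightarrow> complex \<Rightarrow> complex \<Rightarrow> bool" where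
  "same_side B C X Y \<longleftrightarrow> closed_segment X Y \<inter> affine hull {B, C} = {}"

text \<open>
  The ratio does not depend on the labelling of the vertices, so the description is proper for
  every triangle; see \<open>alpha_unique\<close> below.
\<close>

definition alpha :: "complex set \<Rightarrow> real" where
  "alpha \<Delta> = (THE r. \<exists>A B C D D'.
      \<Delta> = {A, B, C} \<and> regular_triangle D B C \<and> regular_triangle D' B C \<and> D \<noteq> D' \<and>
      same_side B C D A \<and> r = dist A D / dist A D')"


section \<open>Well-definedness\<close>

lemma orient_rotate: "orient B C A = orient A B C"
  by (simp add: orient_def algebra_simps)

lemma orient_swap: "orient A C B = - orient A B C"
  by (simp add: orient_def algebra_simps)

lemma collinear_iff_orient: "collinear {A, B, C} \<longleftrightarrow> orient A B C = 0"
proof -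
  have "collinear {A, B, C} \<longleftrightarrow> collinear {0, B - A, C - A}"
    using collinear_3[of B A C] by (cases "B = 0"; simp add: collinear_3 insert_commute)
  also have "\<dots> \<longleftrightarrow> (C - A) / (B - A) \<in> \<real>"
    by (rule collinear_iff_Reals)
  also have "\<dots> \<longleftrightarrow> orient A B C = 0"
  proof (cases "A = B")
    case False
    have "(C - A) / (B - A) = (cnj (B - A) * (C - A)) / (cmod (B - A))\<^sup>2"
      by (simp add: complex_div_cnj[of "C - A"] mult.commute)
    then show ?thesis
      using False by (simp add: complex_is_Real_iff orient_def Im_divide_of_real del: of_real_power)
  qed (simp add: orient_def)
  finally show ?thesis .
qed

lemma triangle_anticlockwise:
  "is_triangle \<Delta> \<longleftrightarrow> (\<exists>A B C. \<Delta> = {A, B, C} \<and> anticlockwise A B C)"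
proof
  assume "is_triangle \<Delta>"
  then obtain A B C where *: "\<Delta> = {A, B, C}" "orient A B C \<noteq> 0"
    unfolding is_triangle_def collinear_iff_orient by blast
  show "\<exists>A B C. \<Delta> = {A, B, C} \<and> anticlockwise A B C"
  proof (cases "orient A B C > 0")
    case True
    then show ?thesis
      unfolding anticlockwise_def by (intro exI conjI) (rule *(1))
  next
    case False
    then have "anticlockwise A C B"
      using *(2) orient_swap[of A C B] unfolding anticlockwise_def by linarith
    moreover have "\<Delta> = {A, C, B}"
      unfolding *(1) by (simp only: insert_commute)
    ultimately show ?thesis
      by (intro exI conjI)
  qed
next
  assume "\<exists>A B C. \<Delta> = {A, B, C} \<and> anticlockwise A B C"
  then obtain A B C where *: "\<Delta> = {A, B, C}" "orient A B C > 0"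
    unfolding anticlockwise_def by blast
  then show "is_triangle \<Delta>"
    unfolding is_triangle_def collinear_iff_orient by (intro exI conjI) (rule *(1), simp)
qed

lemma anticlockwise_distinct: "anticlockwise A B C \<Longrightarrow> A \<noteq> B \<and> B \<noteq> C \<and> A \<noteq> C"
  by (auto simp: anticlockwise_def orient_def algebra_simps)

lemma anticlockwise_listings:
  assumes "anticlockwise A B C" "{A, B, C} = {P, Q, R}" "anticlockwise P Q R"
  shows "(P, Q, R) \<in> {(A, B, C), (B, C, A), (C, A, B)}"
proof -
  have "P \<in> {A, B, C}" "Q \<in> {A, B, C}" "R \<in> {A, B, C}"
    unfolding assms(2) by simp_all
  then have mem: "P = A \<or> P = B \<or> P = C" "Q = A \<or> Q = B \<or> Q = C" "R = A \<or> R = B \<or> R = C"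
    by simp_all
  have neg: "\<not> anticlockwise A C B" "\<not> anticlockwise B A C" "\<not> anticlockwise C B A"
    using assms(1) orient_rotate[of A C B] orient_rotate[of B A C] orient_swap[of A C B]
    unfolding anticlockwise_def by linarith+
  show ?thesis
    using mem neg assms(3) anticlockwise_distinct[OF assms(3)]
    unfolding insert_iff prod.inject empty_iff by blast
qed

lemma equisection_eq:
  assumes "anticlockwise A B C"
  shows "equisection q {A, B, C} =
    {q *\<^sub>R B + (1 - q) *\<^sub>R C, q *\<^sub>R C + (1 - q) *\<^sub>R A, q *\<^sub>R A + (1 - q) *\<^sub>R B}"
    (is "_ = ?R")
proof
  show "equisection q {A, B, C} \<subseteq> ?R"
  proof
    fix z assume "z \<in> equisection q {A, B, C}"
    then obtain X Y Z where z: "z = q *\<^sub>R Y + (1 - q) *\<^sub>R Z"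
      and XYZ: "{A, B, C} = {X, Y, Z}" "anticlockwise X Y Z"
      unfolding equisection_def by blast
    from anticlockwise_listings[OF assms XYZ] show "z \<in> ?R"
      by (auto simp: z)
  qed
  have mem: "q *\<^sub>R Y + (1 - q) *\<^sub>R Z \<in> equisection q {A, B, C}"
    if "{A, B, C} = {X, Y, Z}" "anticlockwise X Y Z" for X Y Z
    unfolding equisection_def
    by (rule CollectI, rule exI[of _ Y], rule exI[of _ Z], rule conjI[OF refl], rule exI[of _ X])
      (simp only: that simp_thms)
  have ac: "anticlockwise B C A" "anticlockwise C A B"
    using assms orient_rotate[of A B C] orient_rotate[of B C A]
    by (simp_all add: anticlockwise_def)
  have "{A, B, C} = {B, C, A}" "{A, B, C} = {C, A, B}"
    by auto
  from mem[OF refl assms] mem[OF this(1) ac(1)] mem[OF this(2) ac(2)]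
  show "?R \<subseteq> equisection q {A, B, C}"
    by (simp only: insert_subset empty_subsetI simp_thms)
qed

lemma anticlockwise_equisection:
  assumes "anticlockwise A B C"
  shows "anticlockwise (q *\<^sub>R B + (1 - q) *\<^sub>R C) (q *\<^sub>R C + (1 - q) *\<^sub>R A) (q *\<^sub>R A + (1 - q) *\<^sub>R B)"
proof -
  have "orient (q *\<^sub>R B + (1 - q) *\<^sub>R C) (q *\<^sub>R C + (1 - q) *\<^sub>R A) (q *\<^sub>R A + (1 - q) *\<^sub>R B) =
      (q\<^sup>2 + (1 - q)\<^sup>2 - q * (1 - q)) * orient A B C"
    by (simp add: orient_def) algebra
  moreover have "q\<^sup>2 + (1 - q)\<^sup>2 - q * (1 - q) = 3 * (q - 1/2)\<^sup>2 + 1/4"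
    by (simp add: power2_eq_square algebra_simps)
  moreover have "3 * (q - 1/2)\<^sup>2 + 1/4 > 0"
    by (rule add_nonneg_pos) auto
  ultimately show ?thesis
    using assms by (simp add: anticlockwise_def)
qed

lemma is_triangle_equisection: "is_triangle \<Delta> \<Longrightarrow> is_triangle (equisection q \<Delta>)"
  unfolding triangle_anticlockwise using anticlockwise_equisection equisection_eq by blast

lemma regular_triangle_iff:
  assumes "B \<noteq> C"
  shows "regular_triangle D B C \<longleftrightarrow>
    D = B + cis (pi/3) * (C - B) \<or> D = B + cis (- pi/3) * (C - B)"
proof -
  define w where "w = (D - B) / (C - B)"
  have D: "D = B + w * (C - B)"
    using assms by (simp add: w_def)
  have "dist D B = cmod w * dist B C" "dist C D = cmod (1 - w) * dist B C"
    by (simp_all add: D dist_norm norm_mult norm_minus_commute flip: norm_mult)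
      (simp_all add: norm_mult norm_minus_commute algebra_simps flip: norm_mult)
  then have "regular_triangle D B C \<longleftrightarrow> cmod w = 1 \<and> cmod (1 - w) = 1"
    using assms by (auto simp: regular_triangle_def)
  also have "\<dots> \<longleftrightarrow> w = cis (pi/3) \<or> w = cis (- pi/3)"
  proof
    assume *: "cmod w = 1 \<and> cmod (1 - w) = 1"
    then have 1: "(Re w)\<^sup>2 + (Im w)\<^sup>2 = 1" "(1 - Re w)\<^sup>2 + (Im w)\<^sup>2 = 1"
      by (auto simp: cmod_def)
    then have 2: "Re w = 1/2"
      by (simp add: power2_eq_square algebra_simps)
    with 1(1) have "(Im w)\<^sup>2 = (sqrt 3 / 2)\<^sup>2"
      by (simp add: power_divide)
    then have "Im w = sqrt 3 / 2 \<or> Im w = - (sqrt 3 / 2)"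
      using power2_eq_iff by blast
    then show "w = cis (pi/3) \<or> w = cis (- pi/3)"
      using 2 by (auto simp: complex_eq_iff cos_60 sin_60)
  qed (auto simp: cmod_def cos_60 sin_60 power2_eq_square)
  also have "\<dots> \<longleftrightarrow> D = B + cis (pi/3) * (C - B) \<or> D = B + cis (- pi/3) * (C - B)"
    using assms by (auto simp: D)
  finally show ?thesis .
qed

lemma affine_hull_iff_orient: "B \<noteq> C \<Longrightarrow> X \<in> affine hull {B, C} \<longleftrightarrow> orient X B C = 0"
  using collinear_3_affine_hull[of B C X] collinear_iff_orient[of B C X]
    orient_rotate[of X B C] orient_rotate[of B C X] by simp

lemma same_side_iff:
  assumes "B \<noteq> C"
  shows "same_side B C X Y \<longleftrightarrow> orient X B C * orient Y B C > 0"
proof -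
  have lin: "orient ((1 - u) *\<^sub>R X + u *\<^sub>R Y) B C = (1 - u) * orient X B C + u * orient Y B C" for u
    by (simp add: orient_def algebra_simps)
  have ss: "same_side B C X Y \<longleftrightarrow>
      (\<forall>u. 0 \<le> u \<and> u \<le> 1 \<longrightarrow> (1 - u) * orient X B C + u * orient Y B C \<noteq> 0)"
    unfolding same_side_def closed_segment_def
    by (auto simp: affine_hull_iff_orient[OF assms] lin disjoint_iff)
  show ?thesis
  proof
    assume "orient X B C * orient Y B C > 0"
    then consider "orient X B C > 0" "orient Y B C > 0" | "orient X B C < 0" "orient Y B C < 0"
      by (auto simp: zero_less_mult_iff)
    then show "same_side B C X Y"
    proof cases
      case 1
      then have "0 < (1 - u) * orient X B C + u * orient Y B C" if "0 \<le> u" "u \<le> 1" for u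
        using that convex_bound_lt[of "- orient X B C" 0 "- orient Y B C" "1 - u" u] by simp
      then show ?thesis
        unfolding ss by (metis less_irrefl)
    next
      case 2
      then have "(1 - u) * orient X B C + u * orient Y B C < 0" if "0 \<le> u" "u \<le> 1" for u
        using that convex_bound_lt[of "orient X B C" 0 "orient Y B C" "1 - u" u] by simp
      then show ?thesis
        unfolding ss by (metis less_irrefl)
    qed
  next
    assume *: "same_side B C X Y"
    let ?x = "orient X B C" and ?y = "orient Y B C"
    show "?x * ?y > 0"
    proof (rule ccontr)
      assume neg: "\<not> ?x * ?y > 0"
      have "?x \<noteq> 0" "?y \<noteq> 0"
        using *[unfolded ss, rule_format, of 0] *[unfolded ss, rule_format, of 1] by auto
      then have "0 \<le> ?x / (?x - ?y) \<and> ?x / (?x - ?y) \<le> 1" "?x \<noteq> ?y"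
        using neg by (auto simp: divide_simps zero_less_mult_iff split: if_splits)
      moreover from this have "(1 - ?x / (?x - ?y)) * ?x + ?x / (?x - ?y) * ?y = 0"
        by (simp add: divide_simps)
      ultimately show False
        using *[unfolded ss] by blast
    qed
  qed
qed

lemma dist_apex:
  "dist A (B + cis (pi/3) * (C - B)) = cmod (A + cis (2*pi/3) * B + cis (- 2*pi/3) * C)"
  "dist A (B + cis (- pi/3) * (C - B)) = cmod (A + cis (- 2*pi/3) * B + cis (2*pi/3) * C)"
proof -
  have c: "cis (2*pi/3) = cis (pi/3) - 1" "cis (- 2*pi/3) = - cis (pi/3)"
     "cis (- 2*pi/3) = cis (- pi/3) - 1" "cis (2*pi/3) = - cis (- pi/3)"
    by (simp_all add: complex_eq_iff cos_60 sin_60 cos_120 sin_120)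
  show "dist A (B + cis (pi/3) * (C - B)) = cmod (A + cis (2*pi/3) * B + cis (- 2*pi/3) * C)"
    unfolding dist_norm c(1,2) by (simp add: algebra_simps)
  show "dist A (B + cis (- pi/3) * (C - B)) = cmod (A + cis (- 2*pi/3) * B + cis (2*pi/3) * C)"
    unfolding dist_norm c(3,4) by (simp add: algebra_simps)
qed

lemma cmod_rotate:
  assumes "w ^ 3 = 1" "w * v = 1"
  shows "cmod (B + w * C + v * A) = cmod (A + w * B + v * C)"
proof -
  have "w ^ 2 = v"
    using assms by algebra
  moreover have "w * (B + w * C + v * A) = w * v * A + w * B + w ^ 2 * C"
    by (simp add: power2_eq_square algebra_simps)
  ultimately have "A + w * B + v * C = w * (B + w * C + v * A)"
    using assms(2) by simp
  moreover have "cmod w = 1"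
    using assms(1) by (metis norm_one norm_power norm_ge_zero power_eq_1_iff zero_neq_numeral)
  ultimately show ?thesis
    by (simp add: norm_mult)
qed

definition shape_ratio :: "complex \<Rightarrow> complex \<Rightarrow> complex \<Rightarrow> real" where
  "shape_ratio A B C =
     cmod (A + cis (2*pi/3) * B + cis (- 2*pi/3) * C) / cmod (A + cis (- 2*pi/3) * B + cis (2*pi/3) * C)"

lemma shape_ratio_rotate: "shape_ratio B C A = shape_ratio A B C"
proof -
  have "cis (2*pi/3) ^ 3 = 1" "cis (- 2*pi/3) ^ 3 = 1"
    unfolding Complex.DeMoivre by (simp_all add: complex_eq_iff)
  moreover have "cis (2*pi/3) * cis (- 2*pi/3) = 1"
    by (simp add: cis_mult)
  ultimately show ?thesis
    unfolding shape_ratio_def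
    using cmod_rotate[of "cis (2*pi/3)" "cis (- 2*pi/3)" B C A]
      cmod_rotate[of "cis (- 2*pi/3)" "cis (2*pi/3)" B C A]
    by (simp add: mult.commute)
qed

lemma orient_apex:
  assumes "B \<noteq> C"
  shows "orient (B + cis (pi/3) * (C - B)) B C > 0" "orient (B + cis (- pi/3) * (C - B)) B C < 0"
proof -
  have "orient (B + w * (C - B)) B C = Im w * (cmod (C - B))\<^sup>2" for w
    unfolding cmod_power2 by (simp add: orient_def) algebra
  then show "orient (B + cis (pi/3) * (C - B)) B C > 0" "orient (B + cis (- pi/3) * (C - B)) B C < 0"
    using assms by (simp_all add: sin_60)
qed

lemma base_ratio:
  assumes "anticlockwise A B C" "regular_triangle D B C" "regular_triangle D' B C" "D \<noteq> D'"
    "same_side B C D A"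
  shows "dist A D / dist A D' = shape_ratio A B C"
proof -
  have BC: "B \<noteq> C"
    using anticlockwise_distinct[OF assms(1)] by simp
  have "orient D B C > 0"
    using assms(1,5) unfolding same_side_iff[OF BC] anticlockwise_def by (simp add: zero_less_mult_iff)
  then have "D = B + cis (pi/3) * (C - B)"
    using assms(2) orient_apex(2)[OF BC] unfolding regular_triangle_iff[OF BC] by (metis less_asym)
  moreover from this have "D' = B + cis (- pi/3) * (C - B)"
    using assms(3,4) unfolding regular_triangle_iff[OF BC] by blast
  ultimately show ?thesis
    unfolding shape_ratio_def by (simp only: dist_apex)
qed

lemma base_ratio_unlabelled:
  assumes "anticlockwise X Y Z" "{X, Y, Z} = {A, B, C}"
    "regular_triangle D B C" "regular_triangle D' B C" "D \<noteq> D'" "same_side B C D A"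
  shows "dist A D / dist A D' = shape_ratio X Y Z"
proof -
  have swap: "regular_triangle D C B" "regular_triangle D' C B" "same_side C B D A"
    using assms(3,4,6)
    by (auto simp: regular_triangle_def same_side_def dist_commute insert_commute)
  have shape: "shape_ratio P Q R = shape_ratio X Y Z"
    if "{X, Y, Z} = {P, Q, R}" "anticlockwise P Q R" for P Q R
    using anticlockwise_listings[OF assms(1) that] shape_ratio_rotate[of X Y Z]
      shape_ratio_rotate[of Y Z X] by auto
  have "orient A B C \<noteq> 0"
    using assms(1) unfolding collinear_iff_orient[symmetric] assms(2)[symmetric]
    by (simp add: collinear_iff_orient anticlockwise_def)
  then consider "anticlockwise A B C" | "anticlockwise A C B"
    unfolding anticlockwise_def orient_swap[of A C B] by linarith
  then show ?thesis
  proof cases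
    case 1
    then show ?thesis
      using base_ratio[OF 1 assms(3-6)] shape[OF assms(2)] by simp
  next
    case 2
    have "{X, Y, Z} = {A, C, B}"
      unfolding assms(2) by (simp only: insert_commute)
    then show ?thesis
      using base_ratio[OF 2 swap(1,2) assms(5) swap(3)] shape[OF _ 2] by simp
  qed
qed

lemma alpha_unique:
  assumes "\<not> collinear {A, B, C}" "regular_triangle D B C" "regular_triangle D' B C" "D \<noteq> D'"
    "same_side B C D A"
  shows "alpha {A, B, C} = dist A D / dist A D'"
proof -
  obtain X Y Z where XYZ: "{A, B, C} = {X, Y, Z}" "anticlockwise X Y Z"
    using assms(1) triangle_anticlockwise[of "{A, B, C}"] unfolding is_triangle_def by blast
  show ?thesis
    unfolding alpha_def
  proof (rule the_equality)
    show "\<exists>A' B' C' E E'. {A, B, C} = {A', B', C'} \<and> regular_triangle E B' C' \<and>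
        regular_triangle E' B' C' \<and> E \<noteq> E' \<and> same_side B' C' E A' \<and>
        dist A D / dist A D' = dist A' E / dist A' E'"
      by (intro exI conjI) (rule refl assms)+
    fix r
    assume "\<exists>A' B' C' E E'. {A, B, C} = {A', B', C'} \<and> regular_triangle E B' C' \<and>
        regular_triangle E' B' C' \<and> E \<noteq> E' \<and> same_side B' C' E A' \<and> r = dist A' E / dist A' E'"
    then obtain A' B' C' E E' where *: "{A, B, C} = {A', B', C'}" "regular_triangle E B' C'"
      "regular_triangle E' B' C'" "E \<noteq> E'" "same_side B' C' E A'" and r: "r = dist A' E / dist A' E'"
      by blast
    show "r = dist A D / dist A D'"
      unfolding r
      using base_ratio_unlabelled[OF XYZ(2) trans[OF XYZ(1)[symmetric] *(1)] *(2-5)]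
        base_ratio_unlabelled[OF XYZ(2) XYZ(1)[symmetric] assms(2-5)] by simp
  qed
qed

lemma alpha_eq:
  assumes "anticlockwise A B C"
  shows "alpha {A, B, C} = shape_ratio A B C"
proof -
  let ?D = "B + cis (pi/3) * (C - B)" and ?D' = "B + cis (- pi/3) * (C - B)"
  have BC: "B \<noteq> C"
    using anticlockwise_distinct[OF assms] by simp
  have reg: "regular_triangle ?D B C" "regular_triangle ?D' B C"
    using regular_triangle_iff[OF BC] by blast+
  have "?D \<noteq> ?D'"
    using orient_apex[OF BC] by (metis less_asym)
  moreover have "same_side B C ?D A"
    unfolding same_side_iff[OF BC] using orient_apex(1)[OF BC] assms by (simp add: anticlockwise_def)
  moreover have "\<not> collinear {A, B, C}"
    using assms by (simp add: collinear_iff_orient anticlockwise_def)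
  ultimately show ?thesis
    using alpha_unique[OF _ reg] base_ratio[OF assms reg] by simp
qed

end

theory Submission
  imports Defs
begin

text \<open>
  Write \<open>\<omega>\<close> for the primitive cube root of unity in the upper half-plane. The ratio of
  \<open>A + \<omega> B + \<omega>\<^sup>2 C\<close> and \<open>A + \<omega> C + \<omega>\<^sup>2 B\<close> determines an anticlockwise
  triangle up to similarity; rotating the labels multiplies it by \<open>\<omega>\<close>, and \<open>T\<^sub>q\<close> multiplies it
  by \<open>\<mu> / cnj \<mu>\<close> with \<open>\<mu> = q \<omega>\<^sup>2 + (1 - q) \<omega>\<close>. As \<open>q\<close> varies, \<open>\<mu>\<close> runs through the line
  \<open>Re \<mu> = - 1/2\<close>, so these factors are all points of the unit circle except \<open>-1\<close>. Hence triangles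
  are equisectionally equivalent iff the absolute values of their ratios, which are the \<open>\<alpha>\<close>, agree.
  For a right triangle with legs in the proportion \<open>1 : k\<close>, \<open>\<alpha>\<close> determines
  \<open>k / (1 + k\<^sup>2)\<close>, that is, \<open>k\<close> up to inversion, and this quantity takes exactly the values
  in the interval from \<open>0\<close> (excluded) to \<open>1/2\<close> (included).
\<close>

section \<open>The complex shape of a triangle\<close>

definition \<omega> :: complex where "\<omega> = cis (2*pi/3)"

lemma \<omega>_sel: "Re \<omega> = - 1/2" "Im \<omega> = sqrt 3 / 2"
  by (simp_all add: \<omega>_def cos_120 sin_120)

lemma \<omega>_eq: "\<omega> = Complex (- 1/2) (sqrt 3 / 2)"
  by (simp add: complex_eq_iff \<omega>_sel)

lemma \<omega>_square: "\<omega>\<^sup>2 = - 1 - \<omega>"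
  by (simp add: \<omega>_eq complex_eq_iff power2_eq_square)

lemma \<omega>_cube: "\<omega> ^ 3 = 1"
  using \<omega>_square by algebra

lemma cnj_\<omega>: "cnj \<omega> = \<omega>\<^sup>2"
  by (simp add: \<omega>_square) (simp add: complex_eq_iff \<omega>_sel)

lemma cis_minus_120: "cis (- 2*pi/3) = \<omega>\<^sup>2"
  unfolding cnj_\<omega>[symmetric] by (simp add: \<omega>_def cis_cnj)

text \<open>A nontrivial discrete Fourier coefficient of the cyclic sequence A, B, C; swapping two
  vertices gives the other one.\<close>

definition third_sum :: "complex \<Rightarrow> complex \<Rightarrow> complex \<Rightarrow> complex" where
  "third_sum A B C = A + \<omega> * B + \<omega>\<^sup>2 * C"

lemma shape_ratio_third_sum: "shape_ratio A B C = cmod (third_sum A B C) / cmod (third_sum A C B)"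
  unfolding shape_ratio_def third_sum_def cis_minus_120 \<omega>_def[symmetric] by (simp add: add_ac)

section \<open>Side lengths, area and \<open>alpha\<close>\<close>

definition sq_sides :: "complex \<Rightarrow> complex \<Rightarrow> complex \<Rightarrow> real" where
  "sq_sides A B C = (dist A B)\<^sup>2 + (dist B C)\<^sup>2 + (dist C A)\<^sup>2"

lemma cmod_third_sum:
  "2 * (cmod (third_sum A B C))\<^sup>2 = sq_sides A B C - 2 * sqrt 3 * orient A B C"
proof -
  have s: "sqrt 3 * (sqrt 3 * x) = 3 * x" for x
    by (simp flip: mult.assoc)
  show ?thesis
    unfolding sq_sides_def dist_norm cmod_power2 third_sum_def \<omega>_square orient_def
    by (simp add: \<omega>_sel power2_eq_square field_simps s)
qed

lemma sq_sides_swap: "sq_sides A C B = sq_sides A B C"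
  by (simp add: sq_sides_def dist_commute)

text \<open>Heron's formula: the side lengths determine the area, hence \<open>orient\<close> up to
  sign.\<close>

lemma heron: "4 * (orient A B C)\<^sup>2 =
    4 * (dist A B)\<^sup>2 * (dist C A)\<^sup>2 - ((dist A B)\<^sup>2 + (dist C A)\<^sup>2 - (dist B C)\<^sup>2)\<^sup>2"
  unfolding dist_norm cmod_power2 orient_def by simp algebra

lemma shape_ratio_sq:
  "(shape_ratio A B C)\<^sup>2 =
    (sq_sides A B C - 2 * sqrt 3 * orient A B C) / (sq_sides A B C + 2 * sqrt 3 * orient A B C)"
proof -
  have "(shape_ratio A B C)\<^sup>2 = (2 * (cmod (third_sum A B C))\<^sup>2) / (2 * (cmod (third_sum A C B))\<^sup>2)"
    unfolding shape_ratio_third_sum power_divide by simp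
  then show ?thesis
    unfolding cmod_third_sum orient_swap[of A C B] sq_sides_swap[of A C B] by simp
qed

text \<open>A form free of orientation: sides and unsigned area suffice, so similarities of both
  kinds can be treated at once.\<close>

lemma alpha_sides:
  assumes "\<not> collinear {A, B, C}"
  shows "alpha {A, B, C} = sqrt ((sq_sides A B C - 2 * sqrt 3 * \<bar>orient A B C\<bar>) /
    (sq_sides A B C + 2 * sqrt 3 * \<bar>orient A B C\<bar>))"
proof -
  have pos: "shape_ratio X Y Z = sqrt ((shape_ratio X Y Z)\<^sup>2)" for X Y Z
    by (simp add: shape_ratio_def)
  consider "anticlockwise A B C" | "anticlockwise A C B"
    using assms unfolding anticlockwise_def collinear_iff_orient orient_swap[of A C B] by linarith
  then show ?thesis
  proof cases
    case 1
    then show ?thesis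
      unfolding alpha_eq[OF 1] by (subst pos, subst shape_ratio_sq) (simp add: anticlockwise_def)
  next
    case 2
    have "{A, B, C} = {A, C, B}" by auto
    then have "alpha {A, B, C} = shape_ratio A C B"
      using alpha_eq[OF 2] by simp
    with 2 show ?thesis
      by (subst (asm) pos, subst (asm) shape_ratio_sq)
        (simp add: anticlockwise_def orient_swap[of A C B] sq_sides_swap)
  qed
qed

text \<open>By \<open>cmod_third_sum\<close> the two terms of the squared modulus add up here
  instead of cancelling. The unswapped sum does vanish for regular triangles, so only this one may
  serve as a denominator.\<close>

lemma third_sum_swap_nonzero:
  assumes "anticlockwise A B C"
  shows "third_sum A C B \<noteq> 0"
proof -
  have "0 \<le> sq_sides A B C" by (simp add: sq_sides_def)
  moreover have "0 < 2 * sqrt 3 * orient A B C"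
    using assms by (simp add: anticlockwise_def)
  ultimately have "0 < 2 * (cmod (third_sum A C B))\<^sup>2"
    unfolding cmod_third_sum orient_swap[of A C B] sq_sides_swap[of A C B] by linarith
  then show ?thesis by auto
qed

section \<open>Similarities\<close>

text \<open>Scaling of distances is enough, without classifying similarities as affine maps: by
  \<open>heron\<close> the unsigned area scales by the square of the factor, and the ratio in
  \<open>alpha_sides\<close> is homogeneous.\<close>

lemma alpha_similarity_image:
  assumes "is_triangle \<Delta>" "similarity f"
  shows "alpha (f ` \<Delta>) = alpha \<Delta>"
proof -
  obtain A B C where \<Delta>: "\<Delta> = {A, B, C}" and nc: "\<not> collinear {A, B, C}"
    using assms(1) unfolding is_triangle_def by blast
  obtain r where r: "r > 0" and d: "\<And>x y. dist (f x) (f y) = r * dist x y"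
    using assms(2) unfolding similarity_def by blast
  have S: "sq_sides (f A) (f B) (f C) = r\<^sup>2 * sq_sides A B C"
    by (simp add: sq_sides_def d power_mult_distrib algebra_simps)
  have "4 * (r * a)\<^sup>2 * (r * c)\<^sup>2 - ((r * a)\<^sup>2 + (r * c)\<^sup>2 - (r * b)\<^sup>2)\<^sup>2 =
      r ^ 4 * (4 * a\<^sup>2 * c\<^sup>2 - (a\<^sup>2 + c\<^sup>2 - b\<^sup>2)\<^sup>2)" for a b c :: real
    by algebra
  then have "4 * (orient (f A) (f B) (f C))\<^sup>2 = r ^ 4 * (4 * (orient A B C)\<^sup>2)"
    unfolding heron d .
  then have "(orient (f A) (f B) (f C))\<^sup>2 = (r\<^sup>2 * orient A B C)\<^sup>2"
    by (simp add: power_mult_distrib flip: power_mult)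
  then have o: "\<bar>orient (f A) (f B) (f C)\<bar> = r\<^sup>2 * \<bar>orient A B C\<bar>"
    unfolding power2_eq_iff by (auto simp: abs_mult)
  have nc': "\<not> collinear {f A, f B, f C}"
    using nc o r by (auto simp: collinear_iff_orient)
  have e: "r\<^sup>2 * s - 2 * sqrt 3 * (r\<^sup>2 * t) = r\<^sup>2 * (s - 2 * sqrt 3 * t)"
    "r\<^sup>2 * s + 2 * sqrt 3 * (r\<^sup>2 * t) = r\<^sup>2 * (s + 2 * sqrt 3 * t)" for s t
    by (simp_all add: algebra_simps)
  have "alpha {f A, f B, f C} = alpha {A, B, C}"
    unfolding alpha_sides[OF nc] alpha_sides[OF nc'] S o e using r by simp
  then show ?thesis by (simp add: \<Delta>)
qed

lemma affine_similarity:
  assumes "p \<noteq> 0" and g: "g = (\<lambda>z. p * z + s)"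
  shows "similarity g" "orientation_preserving g"
proof -
  show "similarity g"
    unfolding similarity_def g
    by (intro exI[of _ "cmod p"])
      (use assms in \<open>auto simp: dist_norm norm_mult simp flip: right_diff_distrib\<close>)
  have "orient (g A) (g B) (g C) = (cmod p)\<^sup>2 * orient A B C" for A B C
    unfolding orient_def cmod_power2 g by simp algebra
  then show "orientation_preserving g"
    using assms by (simp add: orientation_preserving_def anticlockwise_def)
qed

lemma conj_affine_similarity:
  assumes "p \<noteq> 0" and g: "g = (\<lambda>z. p * cnj z + s)"
  shows "similarity g" "orientation_reversing g"
proof -
  have "dist (g x) (g y) = cmod p * dist x y" for x y
  proof -
    have "g x - g y = p * cnj (x - y)" by (simp add: g algebra_simps)
    then show ?thesis by (simp only: dist_norm norm_mult complex_mod_cnj)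
  qed
  then show "similarity g"
    unfolding similarity_def using assms by (intro exI[of _ "cmod p"]) auto
  have "orient (g A) (g C) (g B) = (cmod p)\<^sup>2 * orient A B C" for A B C
    unfolding orient_def cmod_power2 g by simp algebra
  then show "orientation_reversing g"
    using assms by (simp add: orientation_reversing_def anticlockwise_def)
qed

text \<open>The hypothesis is equality of the complex shapes, cross-multiplied. The map z -> p z + s
  is fitted to the swapped third sum and to the centroid; the hypothesis then matches the remaining
  third sum, and these three data determine the vertices.\<close>

lemma similar_if_third_sums:
  assumes "anticlockwise A B C" "anticlockwise A' B' C'"
    and eq: "third_sum A' B' C' * third_sum A C B = third_sum A B C * third_sum A' C' B'"
  shows "similar {A, B, C} {A', B', C'}"
proof -
  define p where "p = third_sum A' C' B' / third_sum A C B"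
  define s where "s = ((A' + B' + C') - p * (A + B + C)) / 3"
  note nz = third_sum_swap_nonzero[OF assms(1)] third_sum_swap_nonzero[OF assms(2)]
  have p: "p \<noteq> 0" using nz by (simp add: p_def)
  have 1: "third_sum A' C' B' = p * third_sum A C B"
    using nz by (simp add: p_def)
  have 2: "third_sum A' B' C' = p * third_sum A B C"
    using nz eq by (simp add: p_def divide_simps mult.commute)
  have 3: "3 * s = (A' + B' + C') - p * (A + B + C)"
    by (simp add: s_def)
  \<comment> \<open>Inverse discrete Fourier transform on three points.\<close>
  have inv: "3 * X = (X + Y + Z) + third_sum X Y Z + third_sum X Z Y"
    "3 * Y = (X + Y + Z) + \<omega>\<^sup>2 * third_sum X Y Z + \<omega> * third_sum X Z Y"
    "3 * Z = (X + Y + Z) + \<omega> * third_sum X Y Z + \<omega>\<^sup>2 * third_sum X Z Y" for X Y Z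
    unfolding third_sum_def using \<omega>_square by algebra+
  have 4: "3 * (p * X + s) = p * (3 * X) + 3 * s" for X
    by algebra
  have "3 * (p * A + s) = 3 * A'" "3 * (p * B + s) = 3 * B'" "3 * (p * C + s) = 3 * C'"
    unfolding 4 3 inv[where X = A and Y = B and Z = C]
      inv[where X = A' and Y = B' and Z = C'] 1 2 by algebra+
  then have "p * A + s = A'" "p * B + s = B'" "p * C + s = C'"
    by (simp_all only: mult_cancel_left) simp_all
  then have "(\<lambda>z. p * z + s) ` {A, B, C} = {A', B', C'}"
    by simp
  then show ?thesis
    unfolding similar_def using affine_similarity[OF p refl] by blast
qed

section \<open>Equisection and \<open>\<alpha>\<close>\<close>

definition equi_mult :: "real \<Rightarrow> complex" where
  "equi_mult q = of_real q * \<omega>\<^sup>2 + (1 - of_real q) * \<omega>"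

text \<open>Equisection is a circulant linear map of the vertices, so the Fourier coefficients are
  multiplied by its eigenvalues; these are conjugate because \<open>q\<close> is real.\<close>

lemma third_sum_equisection:
  fixes q :: real
  defines "A' \<equiv> \<lambda>X Y :: complex. q *\<^sub>R X + (1 - q) *\<^sub>R Y"
  shows "third_sum (A' B C) (A' C A) (A' A B) = equi_mult q * third_sum A B C"
    and "third_sum (A' B C) (A' A B) (A' C A) = cnj (equi_mult q) * third_sum A C B"
proof -
  have "\<omega> ^ 4 = \<omega>" using \<omega>_cube by algebra
  then have c: "cnj (equi_mult q) = of_real q * \<omega> + (1 - of_real q) * \<omega>\<^sup>2"
    unfolding equi_mult_def by (simp add: cnj_\<omega>)
  show "third_sum (A' B C) (A' C A) (A' A B) = equi_mult q * third_sum A B C"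
    unfolding A'_def third_sum_def equi_mult_def scaleR_conv_of_real of_real_diff of_real_1
    using \<omega>_cube by algebra
  show "third_sum (A' B C) (A' A B) (A' C A) = cnj (equi_mult q) * third_sum A C B"
    unfolding A'_def third_sum_def c scaleR_conv_of_real of_real_diff of_real_1
    using \<omega>_cube by algebra
qed

lemma equi_mult_sel: "Re (equi_mult q) = - 1/2" "Im (equi_mult q) = (1 - 2 * q) * (sqrt 3 / 2)"
  by (simp_all add: equi_mult_def \<omega>_square \<omega>_sel algebra_simps)

lemma equi_mult_nonzero: "equi_mult q \<noteq> 0"
  using equi_mult_sel(1)[of q] by auto

lemma exists_equi_mult:
  assumes "cmod u = 1" "u \<noteq> - 1"
  shows "\<exists>q. equi_mult q = u * cnj (equi_mult q)"
proof -
  have sq: "(Re u)\<^sup>2 + (Im u)\<^sup>2 = 1"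
    using assms(1) by (simp add: cmod_def)
  have ne: "1 + Re u \<noteq> 0"
  proof
    assume "1 + Re u = 0"
    then have "Re u = - 1" by simp
    moreover from this sq have "Im u = 0" by simp
    ultimately show False using assms(2) by (simp add: complex_eq_iff)
  qed
  \<comment> \<open>The tangent of half the argument of \<open>u\<close>, so that u = (1 + i t) / (1
    - i t).\<close>
  define t where "t = Im u / (1 + Re u)"
  have t: "t * (1 + Re u) = Im u" using ne by (simp add: t_def)
  \<comment> \<open>Chosen to make \<open>equi_mult q\<close> equal to -(1 + i t) / 2.\<close>
  define q where "q = (1 + t / sqrt 3) / 2"
  have m: "equi_mult q = Complex (- 1/2) (- t / 2)"
    by (simp add: complex_eq_iff equi_mult_sel q_def field_simps)
  \<comment> \<open>After cancelling 1 + Re u, these are the real and imaginary parts of u (1 - i t)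
    = 1 + i t.\<close>
  have "(1 + Re u) * (Re u + t * Im u) = (1 + Re u) * 1" "(1 + Re u) * (Im u - t * Re u) = (1 + Re u) * t"
    using sq t by algebra+
  then have "Re u + t * Im u = 1" "Im u - t * Re u = t"
    using ne by (simp_all only: mult_cancel_left simp_thms)
  then have "equi_mult q = u * cnj (equi_mult q)"
    unfolding m by (simp add: complex_eq_iff algebra_simps)
  then show ?thesis ..
qed

lemma alpha_equisection:
  assumes "is_triangle \<Delta>"
  shows "alpha (equisection q \<Delta>) = alpha \<Delta>"
proof -
  obtain A B C where \<Delta>: "\<Delta> = {A, B, C}" and ac: "anticlockwise A B C"
    using assms unfolding triangle_anticlockwise by blast
  show ?thesis
    unfolding \<Delta> equisection_eq[OF ac] alpha_eq[OF ac] alpha_eq[OF anticlockwise_equisection[OF ac]]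
      shape_ratio_third_sum third_sum_equisection norm_mult
    using equi_mult_nonzero by simp
qed

section \<open>Equality of \<open>alpha\<close> as the criterion for equivalence\<close>

lemma alpha_equisectionally_equivalent:
  assumes "equisectionally_equivalent \<Delta> \<Delta>'"
  shows "alpha \<Delta> = alpha \<Delta>'"
proof -
  have step: "alpha X = alpha Y" if "equisection_step X Y" for X Y
    using that alpha_similarity_image alpha_equisection
    unfolding equisection_step_def similar_def by metis
  show ?thesis
    using assms unfolding equisectionally_equivalent_def
    by (induction rule: equivclp_induct) (auto dest: step)
qed

text \<open>A single equisection followed by a similarity suffices: \<open>q\<close> is chosen so
  that the equisection supplies exactly the factor \<open>u\<close>.\<close>

lemma equivalent_if_rotated:
  assumes ac: "anticlockwise A B C" and ac': "anticlockwise A' B' C'"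
    and u: "cmod u = 1" "u \<noteq> - 1"
    and eq: "third_sum A' B' C' * third_sum A C B = u * (third_sum A B C * third_sum A' C' B')"
  shows "equisectionally_equivalent {A, B, C} {A', B', C'}"
proof -
  obtain q where q: "equi_mult q = u * cnj (equi_mult q)"
    using exists_equi_mult[OF u] by blast
  let ?E = "equisection q {A, B, C}"
  have tri: "is_triangle {A, B, C}" "is_triangle {A', B', C'}"
    using ac ac' unfolding triangle_anticlockwise by blast+
  have "similar ?E {A', B', C'}"
    unfolding equisection_eq[OF ac]
  proof (rule similar_if_third_sums[OF anticlockwise_equisection[OF ac] ac'])
    show "third_sum A' B' C' * third_sum (q *\<^sub>R B + (1 - q) *\<^sub>R C) (q *\<^sub>R A + (1 - q) *\<^sub>R B) (q *\<^sub>R C + (1 - q) *\<^sub>R A) =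
      third_sum (q *\<^sub>R B + (1 - q) *\<^sub>R C) (q *\<^sub>R C + (1 - q) *\<^sub>R A) (q *\<^sub>R A + (1 - q) *\<^sub>R B) * third_sum A' C' B'"
      unfolding third_sum_equisection using eq q by algebra
  qed
  then have "equisection_step {A, B, C} ?E" "equisection_step ?E {A', B', C'}"
    using tri is_triangle_equisection[OF tri(1)] unfolding equisection_step_def by blast+
  then show ?thesis
    unfolding equisectionally_equivalent_def by (meson equivclp_into_equivclp r_into_equivclp)
qed

lemma equisectionally_equivalent_iff_alpha:
  assumes "is_triangle \<Delta>" "is_triangle \<Delta>'"
  shows "equisectionally_equivalent \<Delta> \<Delta>' \<longleftrightarrow> alpha \<Delta> = alpha \<Delta>'"
proof
  assume al: "alpha \<Delta> = alpha \<Delta>'"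
  obtain A B C where \<Delta>: "\<Delta> = {A, B, C}" and ac: "anticlockwise A B C"
    using assms(1) unfolding triangle_anticlockwise by blast
  obtain A' B' C' where \<Delta>': "\<Delta>' = {A', B', C'}" and ac': "anticlockwise A' B' C'"
    using assms(2) unfolding triangle_anticlockwise by blast
  define x where "x = third_sum A' B' C' * third_sum A C B"
  define y where "y = third_sum A B C * third_sum A' C' B'"
  have "cmod x = cmod y"
    using al third_sum_swap_nonzero[OF ac] third_sum_swap_nonzero[OF ac']
    unfolding \<Delta> \<Delta>' alpha_eq[OF ac] alpha_eq[OF ac'] shape_ratio_third_sum x_def y_def
    by (simp add: norm_mult divide_simps)
  \<comment> \<open>If y = 0, then x = 0 as well (both triangles are regular), and u = 1
    serves.\<close>
  then obtain u where u: "cmod u = 1" and xy: "x = u * y"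
    by (cases "y = 0") (auto intro: that[of 1] that[of "x / y"] simp: norm_divide)
  show "equisectionally_equivalent \<Delta> \<Delta>'"
  proof (cases "u = - 1")
    case False
    then show ?thesis
      using equivalent_if_rotated[OF ac ac' u] xy unfolding \<Delta> \<Delta>' x_def y_def by blast
  next
    case True
    \<comment> \<open>Rotating the labels of \<open>\<Delta>'\<close> turns the unattainable factor \<open>-1\<close> into \<open>- \<omega>\<close>.\<close>
    have ac'': "anticlockwise B' C' A'"
      using ac' orient_rotate by (simp add: anticlockwise_def)
    have \<omega>: "cmod (- \<omega>) = 1" "- \<omega> \<noteq> - 1"
      by (simp add: \<omega>_def) (auto dest: arg_cong[where f = Re] simp: \<omega>_sel)
    have "third_sum B' C' A' = \<omega>\<^sup>2 * third_sum A' B' C'" "third_sum B' A' C' = \<omega> * third_sum A' C' B'"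
      unfolding third_sum_def using \<omega>_cube by algebra+
    then have "third_sum B' C' A' * third_sum A C B = - \<omega> * (third_sum A B C * third_sum B' A' C')"
      using xy True unfolding x_def y_def by algebra
    from equivalent_if_rotated[OF ac ac'' \<omega> this] show ?thesis
      unfolding \<Delta> \<Delta>' by (simp add: insert_commute)
  qed
qed (rule alpha_equisectionally_equivalent)

section \<open>Right triangles\<close>

definition legs_triangle :: "complex \<Rightarrow> complex \<Rightarrow> real \<Rightarrow> complex set" where
  "legs_triangle A d k = {A, A + d, A + \<i> * of_real k * d}"

lemma orient_legs: "orient A (A + d) (A + \<i> * of_real k * d) = k * (cmod d)\<^sup>2"
  unfolding orient_def cmod_power2 by simp algebra

text \<open>Either leg can be taken as \<open>d\<close>; the choice that lists the vertices
  anticlockwise makes \<open>k\<close> positive.\<close>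

lemma right_triangle_iff_legs:
  "right_triangle \<Delta> \<longleftrightarrow> (\<exists>A d k. d \<noteq> 0 \<and> k > 0 \<and> \<Delta> = legs_triangle A d k)"
proof
  assume "right_triangle \<Delta>"
  then obtain A B C where \<Delta>: "\<Delta> = {A, B, C}" and nc: "orient A B C \<noteq> 0"
    and orth: "orthogonal (B - A) (C - A)"
    unfolding right_triangle_def collinear_iff_orient by blast
  have main: "\<exists>d k. d \<noteq> 0 \<and> k > 0 \<and> {A, P, Q} = legs_triangle A d k"
    if "orient A P Q > 0" "orthogonal (P - A) (Q - A)" for P Q
  proof -
    have nz: "P - A \<noteq> 0" using that(1) by (auto simp: orient_def)
    \<comment> \<open>With a right angle at \<open>A\<close>, \<open>orient\<close> is the product
      of the leg lengths, so this is their ratio.\<close>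
    define k where "k = orient A P Q / (cmod (P - A))\<^sup>2"
    have k: "k > 0" using that(1) nz by (simp add: k_def)
    have "cnj (P - A) * (Q - A) = \<i> * of_real (orient A P Q)"
      using that(2) by (simp add: complex_eq_iff orient_def orthogonal_def inner_complex_def algebra_simps)
    then have "((P - A) * cnj (P - A)) * (Q - A) = \<i> * of_real (orient A P Q) * (P - A)"
      by algebra
    then have "of_real ((cmod (P - A))\<^sup>2) * (Q - A) = \<i> * of_real (orient A P Q) * (P - A)"
      by (simp only: complex_norm_square)
    then have "Q - A = \<i> * of_real k * (P - A)"
      using nz by (simp add: k_def divide_simps mult_ac)
    then have "Q = A + \<i> * of_real k * (P - A)"
      by (simp add: algebra_simps)
    then show ?thesis
      using nz k by (intro exI[of _ "P - A"] exI[of _ k]) (simp add: legs_triangle_def)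
  qed
  have "\<Delta> = {A, C, B}" "orthogonal (C - A) (B - A)"
    using \<Delta> orth by (auto simp: orthogonal_commute)
  moreover have "orient A B C > 0 \<or> orient A C B > 0"
    using nc orient_swap[of A C B] by linarith
  ultimately show "\<exists>A d k. d \<noteq> 0 \<and> k > 0 \<and> \<Delta> = legs_triangle A d k"
    using main[of B C] main[of C B] \<Delta> orth by metis
next
  assume "\<exists>A d k. d \<noteq> 0 \<and> k > 0 \<and> \<Delta> = legs_triangle A d k"
  then obtain A d k where *: "d \<noteq> 0" "k > 0" "\<Delta> = legs_triangle A d k" by blast
  show "right_triangle \<Delta>"
    unfolding right_triangle_def *(3) legs_triangle_def collinear_iff_orient
    by (intro exI conjI, rule refl, unfold orient_legs)
      (use * in \<open>simp_all add: orthogonal_def inner_complex_def\<close>)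
qed

lemma right_triangle_is_triangle: "right_triangle \<Delta> \<Longrightarrow> is_triangle \<Delta>"
  unfolding right_triangle_def is_triangle_def by blast

lemma alpha_legs:
  assumes "d \<noteq> 0" "k > 0"
  shows "alpha (legs_triangle A d k) =
    sqrt ((1 - sqrt 3 * (k / (1 + k\<^sup>2))) / (1 + sqrt 3 * (k / (1 + k\<^sup>2))))"
proof -
  have S: "sq_sides A (A + d) (A + \<i> * of_real k * d) = 2 * (1 + k\<^sup>2) * (cmod d)\<^sup>2"
    unfolding sq_sides_def dist_norm cmod_power2 by simp algebra
  have nc: "\<not> collinear {A, A + d, A + \<i> * of_real k * d}"
    using assms unfolding collinear_iff_orient orient_legs by simp
  \<comment> \<open>The sum of the squared sides, twice the squared hypotenuse; it cancels from the
    ratio.\<close>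
  define m where "m = 2 * (1 + k\<^sup>2) * (cmod d)\<^sup>2"
  have k2: "1 + k\<^sup>2 > 0" by (simp add: add_pos_nonneg)
  then have m: "m > 0" using assms by (simp add: m_def)
  have o: "2 * sqrt 3 * \<bar>k * (cmod d)\<^sup>2\<bar> = m * (sqrt 3 * (k / (1 + k\<^sup>2)))"
    using assms k2 by (simp add: m_def abs_mult field_simps)
  have "(m - m * x) / (m + m * x) = (1 - x) / (1 + x)" for x
  proof -
    have "(m - m * x) / (m + m * x) = (m * (1 - x)) / (m * (1 + x))"
      by (simp add: algebra_simps)
    then show ?thesis using m by simp
  qed
  then show ?thesis
    unfolding legs_triangle_def alpha_sides[OF nc] S orient_legs m_def[symmetric] o by (simp only:)
qed

text \<open>The map x -> (1 - x) / (1 + x) is injective where 1 + x > 0, and equality of the two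
  values of k / (1 + k^2) factors as (k - k') (1 - k k') = 0.\<close>

lemma alpha_legs_eq_iff:
  assumes "d \<noteq> 0" "k > 0" "d' \<noteq> 0" "k' > 0"
  shows "alpha (legs_triangle A d k) = alpha (legs_triangle A' d' k') \<longleftrightarrow> k = k' \<or> k * k' = 1"
proof -
  have pos: "1 + x\<^sup>2 > 0" for x :: real by (simp add: add_pos_nonneg)
  have c: "1 + sqrt 3 * (x / (1 + x\<^sup>2)) > 0" if "x > 0" for x
    using that pos[of x] by (intro add_pos_nonneg) auto
  have "(1 - x) / (1 + x) = (1 - y) / (1 + y) \<longleftrightarrow> x = y" if "1 + x > 0" "1 + y > 0" for x y :: real
    using that by (simp add: divide_simps) (auto simp: algebra_simps)
  then have "alpha (legs_triangle A d k) = alpha (legs_triangle A' d' k') \<longleftrightarrow>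
      k / (1 + k\<^sup>2) = k' / (1 + k'\<^sup>2)"
    unfolding alpha_legs[OF assms(1,2)] alpha_legs[OF assms(3,4)] real_sqrt_eq_iff
    using c[OF assms(2)] c[OF assms(4)] by (simp only: mult_cancel_left) simp
  also have "\<dots> \<longleftrightarrow> k * (1 + k'\<^sup>2) = k' * (1 + k\<^sup>2)"
    using pos[of k] pos[of k'] by (simp add: frac_eq_eq)
  also have "\<dots> \<longleftrightarrow> (k - k') * (1 - k * k') = 0"
    by (simp add: power2_eq_square algebra_simps)
  finally show ?thesis by auto
qed

lemma right_triangles_alpha_iff:
  assumes "right_triangle \<Delta>" "right_triangle \<Delta>'"
  shows "alpha \<Delta> = alpha \<Delta>' \<longleftrightarrow> similar \<Delta> \<Delta>' \<or> reversely_similar \<Delta> \<Delta>'"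
proof
  assume al: "alpha \<Delta> = alpha \<Delta>'"
  obtain A d k where D: "d \<noteq> 0" "k > 0" "\<Delta> = legs_triangle A d k"
    using assms(1) unfolding right_triangle_iff_legs by blast
  obtain A' d' k' where D': "d' \<noteq> 0" "k' > 0" "\<Delta>' = legs_triangle A' d' k'"
    using assms(2) unfolding right_triangle_iff_legs by blast
  consider "k = k'" | "k * k' = 1"
    using al alpha_legs_eq_iff[OF D(1,2) D'(1,2)] unfolding D(3) D'(3) by blast
  then show "similar \<Delta> \<Delta>' \<or> reversely_similar \<Delta> \<Delta>'"
  proof cases
    case 1
    define p where "p = d' / d"
    have pd: "p \<noteq> 0" "p * d = d'" using D(1) D'(1) by (simp_all add: p_def)
    have "(\<lambda>z. p * z + (A' - p * A)) ` \<Delta> = \<Delta>'"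
      unfolding D(3) D'(3) legs_triangle_def pd(2)[symmetric] 1 by (simp add: algebra_simps)
    then show ?thesis
      unfolding similar_def using affine_similarity[OF pd(1) refl] by blast
  next
    case 2
    \<comment> \<open>The reflecting map swaps the roles of the legs: conjugation followed by
      multiplication by \<open>p\<close> takes \<open>d\<close> to the second leg of the target, and
      k k' = 1 makes the other leg land on \<open>d'\<close>.\<close>
    define p where "p = \<i> * of_real k' * d' / cnj d"
    have pd: "p \<noteq> 0" "p * cnj d = \<i> * of_real k' * d'" using D D' by (simp_all add: p_def)
    have "of_real k * of_real k' = (1 :: complex)"
      using 2 by (metis of_real_1 of_real_mult)
    then have "p * cnj (\<i> * of_real k * d) = d'"
      using pd(2) by simp (use i_squared in algebra)
    then have "p * cnj A + (A' - p * cnj A) = A'"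
      "p * cnj (A + d) + (A' - p * cnj A) = A' + \<i> * of_real k' * d'"
      "p * cnj (A + \<i> * of_real k * d) + (A' - p * cnj A) = A' + d'"
      using pd(2) by (simp_all only: complex_cnj_add distrib_left) simp_all
    then have "(\<lambda>z. p * cnj z + (A' - p * cnj A)) ` \<Delta> = \<Delta>'"
      unfolding D(3) D'(3) legs_triangle_def image_insert image_empty by (simp only: insert_commute)
    then show ?thesis
      unfolding reversely_similar_def using conj_affine_similarity[OF pd(1) refl] by blast
  qed
next
  assume "similar \<Delta> \<Delta>' \<or> reversely_similar \<Delta> \<Delta>'"
  then show "alpha \<Delta> = alpha \<Delta>'"
    using alpha_similarity_image[OF right_triangle_is_triangle[OF assms(1)]]
    unfolding similar_def reversely_similar_def by metis
qed

section \<open>The values of \<open>alpha\<close> on right triangles\<close>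

lemma alpha_less_1:
  assumes "is_triangle \<Delta>"
  shows "alpha \<Delta> < 1"
proof -
  obtain A B C where \<Delta>: "\<Delta> = {A, B, C}" and ac: "anticlockwise A B C"
    using assms unfolding triangle_anticlockwise by blast
  have o: "0 < 2 * sqrt 3 * orient A B C"
    using ac by (simp add: anticlockwise_def)
  moreover have "0 \<le> sq_sides A B C" by (simp add: sq_sides_def)
  ultimately have "(alpha \<Delta>)\<^sup>2 < 1"
    unfolding \<Delta> alpha_eq[OF ac] shape_ratio_sq by (subst divide_less_eq_1_pos) linarith+
  then show "alpha \<Delta> < 1"
    by (simp add: power_less_one_iff abs_square_less_1)
qed

text \<open>The ratio decreases in \<open>t\<close>, and the constant on the left, 7 - 4 sqrt 3, is
  its value at t = 1/2, the case of the isosceles right triangle.\<close>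

lemma ratio_lower_bound_iff:
  fixes t :: real
  assumes "0 \<le> t"
  shows "((sqrt 3 - 1)\<^sup>2 / 2)\<^sup>2 \<le> (1 - sqrt 3 * t) / (1 + sqrt 3 * t) \<longleftrightarrow> t \<le> 1/2"
proof -
  have s: "sqrt 3 * (sqrt 3 * x) = 3 * x" for x
    by (simp flip: mult.assoc)
  have c: "((sqrt 3 - 1)\<^sup>2 / 2)\<^sup>2 = 7 - 4 * sqrt 3"
  proof -
    have "(sqrt 3 - 1)\<^sup>2 / 2 = 2 - sqrt 3"
      by (simp add: power2_eq_square field_simps)
    then show ?thesis by (simp only:) (simp add: power2_eq_square algebra_simps)
  qed
  have "1 + sqrt 3 * t > 0" using assms by (simp add: add_pos_nonneg)
  then have "((sqrt 3 - 1)\<^sup>2 / 2)\<^sup>2 \<le> (1 - sqrt 3 * t) / (1 + sqrt 3 * t) \<longleftrightarrow>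
      (7 - 4 * sqrt 3) * (1 + sqrt 3 * t) \<le> 1 - sqrt 3 * t"
    unfolding c by (simp add: pos_le_divide_eq)
  also have "\<dots> \<longleftrightarrow> 0 \<le> (2 * sqrt 3 - 3) * (1 - 2 * t)"
  proof -
    have "1 - sqrt 3 * t - (7 - 4 * sqrt 3) * (1 + sqrt 3 * t) = 2 * ((2 * sqrt 3 - 3) * (1 - 2 * t))"
      by (simp add: s algebra_simps)
    then show ?thesis by linarith
  qed
  also have "\<dots> \<longleftrightarrow> t \<le> 1/2"
  proof -
    have "3/2 < sqrt 3" by (rule real_less_rsqrt) (simp add: power2_eq_square)
    then show ?thesis by (simp add: zero_le_mult_iff mult.commute)
  qed
  finally show ?thesis .
qed

lemma alpha_right_triangle_ge:
  assumes "right_triangle \<Delta>"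
  shows "(sqrt 3 - 1)\<^sup>2 / 2 \<le> alpha \<Delta>"
proof -
  obtain A d k where D: "d \<noteq> 0" "k > 0" "\<Delta> = legs_triangle A d k"
    using assms unfolding right_triangle_iff_legs by blast
  have pos: "1 + k\<^sup>2 > 0" by (simp add: add_pos_nonneg)
  \<comment> \<open>Expands to 2 k \<le> 1 + k^2, which bounds k / (1 + k^2) by 1/2.\<close>
  have "0 \<le> (k - 1)\<^sup>2" by simp
  then have "k / (1 + k\<^sup>2) \<le> 1/2" "0 \<le> k / (1 + k\<^sup>2)"
    using pos D(2) by (simp_all add: pos_divide_le_eq power2_eq_square algebra_simps)
  then show ?thesis
    unfolding D(3) alpha_legs[OF D(1,2)] by (intro real_le_rsqrt) (simp only: ratio_lower_bound_iff)
qed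

lemma exists_right_triangle_alpha:
  assumes "(sqrt 3 - 1)\<^sup>2 / 2 \<le> a" "a < 1"
  shows "\<exists>\<Delta>. right_triangle \<Delta> \<and> alpha \<Delta> = a"
proof -
  have a0: "0 \<le> a"
    using assms(1) by (rule order_trans[rotated]) simp
  \<comment> \<open>The solution of (1 - sqrt 3 t) / (1 + sqrt 3 t) = a^2.\<close>
  define t where "t = (1 - a\<^sup>2) / (sqrt 3 * (1 + a\<^sup>2))"
  have a2: "1 + a\<^sup>2 > 0" "a\<^sup>2 < 1"
    using a0 assms(2) by (simp_all add: add_pos_nonneg power_less_one_iff abs_square_less_1)
  then have t0: "t > 0" by (simp add: t_def)
  have st: "sqrt 3 * t = (1 - a\<^sup>2) / (1 + a\<^sup>2)" by (simp add: t_def)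
  have at: "(1 - sqrt 3 * t) / (1 + sqrt 3 * t) = a\<^sup>2"
    unfolding st using a2 by (simp add: divide_simps)
  have "((sqrt 3 - 1)\<^sup>2 / 2)\<^sup>2 \<le> a\<^sup>2"
    using assms(1) by (intro power_mono) auto
  then have th: "t \<le> 1/2"
    using ratio_lower_bound_iff[of t] t0 at by simp
  define r where "r = sqrt (1 - 4 * t\<^sup>2)"
  have "t\<^sup>2 \<le> (1/2)\<^sup>2" using t0 th by (intro power_mono) auto
  then have r: "r\<^sup>2 = 1 - 4 * t\<^sup>2" "0 \<le> r"
    by (simp_all add: r_def power_divide)
  \<comment> \<open>The larger root of t k^2 - k + t = 0, that is, of k / (1 + k^2) = t; the
    discriminant is nonnegative because t \<le> 1/2. The roots are mutually inverse, so the other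
    one only swaps the legs.\<close>
  define k where "k = (1 + r) / (2 * t)"
  have k0: "k > 0" using r(2) t0 by (simp add: k_def)
  have "2 * t * k = 1 + r" using t0 by (simp add: k_def)
  then have "4 * t * (t * (1 + k\<^sup>2)) = 4 * t * k"
    using r(1) by algebra
  then have "t * (1 + k\<^sup>2) = k" using t0 by simp
  moreover have "1 + k\<^sup>2 \<noteq> 0"
    using zero_le_power2[of k] by linarith
  ultimately have kt: "k / (1 + k\<^sup>2) = t"
    by (simp add: nonzero_divide_eq_eq)
  have "alpha (legs_triangle 0 1 k) = a"
    using alpha_legs[of 1 k 0] k0 a0 unfolding kt at by simp
  moreover have "right_triangle (legs_triangle 0 1 k)"
    unfolding right_triangle_iff_legs using k0 zero_neq_one by metis
  ultimately show ?thesis by blast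
qed

theorem corollary3:
  shows "(\<forall>\<Delta> \<Delta>'. right_triangle \<Delta> \<longrightarrow> right_triangle \<Delta>' \<longrightarrow>
            (equisectionally_equivalent \<Delta> \<Delta>' \<longleftrightarrow> similar \<Delta> \<Delta>' \<or> reversely_similar \<Delta> \<Delta>')) \<and>
         (\<forall>\<Delta>. is_triangle \<Delta> \<longrightarrow>
            ((\<exists>\<Delta>'. right_triangle \<Delta>' \<and> equisectionally_equivalent \<Delta> \<Delta>') \<longleftrightarrow>
             alpha \<Delta> \<ge> (sqrt 3 - 1)\<^sup>2 / 2))"
proof (intro conjI allI impI)
  fix \<Delta> \<Delta>' assume "right_triangle \<Delta>" "right_triangle \<Delta>'"
  then show "equisectionally_equivalent \<Delta> \<Delta>' \<longleftrightarrow> similar \<Delta> \<Delta>' \<or> reversely_similar \<Delta> \<Delta>'"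
    by (simp add: equisectionally_equivalent_iff_alpha right_triangle_is_triangle
        right_triangles_alpha_iff)
next
  fix \<Delta> assume "is_triangle \<Delta>"
  then have "(\<exists>\<Delta>'. right_triangle \<Delta>' \<and> equisectionally_equivalent \<Delta> \<Delta>') \<longleftrightarrow>
      (\<exists>\<Delta>'. right_triangle \<Delta>' \<and> alpha \<Delta>' = alpha \<Delta>)"
    by (metis equisectionally_equivalent_iff_alpha right_triangle_is_triangle)
  also have "\<dots> \<longleftrightarrow> (sqrt 3 - 1)\<^sup>2 / 2 \<le> alpha \<Delta>"
    using alpha_right_triangle_ge exists_right_triangle_alpha alpha_less_1[OF \<open>is_triangle \<Delta>\<close>]
    by metis
  finally show "(\<exists>\<Delta>'. right_triangle \<Delta>' \<and> equisectionally_equivalent \<Delta> \<Delta>') \<longleftrightarrow>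
      alpha \<Delta> \<ge> (sqrt 3 - 1)\<^sup>2 / 2" .
qed

end
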